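(* Let $k \ge 1$, $m = 4k+3$, $\theta = 2\pi/m$, and let $P$ be a finite point set in general position. For any two vertices $u, w \in P$, let $M$ be the midpoint of the side of $T_{uw}$ opposite $u$ and let $\alpha$ be the unsigned angle between $uw$ and $uM$. Then the $\theta_m$-graph on $P$ contains a path from $u$ to $w$ of length at most $$\left(\frac{\cos\alpha}{\cos(\theta/2)} + \frac{(\cos\alpha\tan(\theta/2) + \sin\alpha)\cos(\theta/4)}{\cos(\theta/2) - \sin(3\theta/4)}\right)|uw|.$$
   Context: Cones: for $m \ge 2$, $\theta = 2\pi/m$; around each point $u$ draw $m$ rays with consecutive angular separation $\theta$, oriented so the vertical upward ray from $u$ bisects a cone $C_0^u$; cones numbered $C_0^u,\dots,C_{m-1}^u$ clockwise, same orientation at every point. General position: no two points on a line parallel to a cone boundary ray, no two on a line perpendicular to a cone bisector, no three collinear. The $\theta_m$-graph on $P$: for each $u\in P$ and each cone $C_i^u$ containing another point of $P$, add an edge from $u$ to the point of $C_i^u$ whose orthogonal projection onto the bisector of $C_i^u$ is closest to $u$; edges weighted by Euclidean length. Canonical triangle: if $w$ lies in cone $C$ of $u$, $T_{uw}$ is the triangle bounded by the two boundary rays of $C$ and the line through $w$ perpendicular to the bisector of $C$. *)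

theory Defs
  imports "HOL-Analysis.Analysis"
begin

type_synonym pt = "real \<times> real"

definition theta :: "nat \<Rightarrow> real" where
  "theta m = 2 * pi / real m"

definition dir :: "real \<Rightarrow> pt" where
  "dir phi = (cos phi, sin phi)"

text \<open>Bisector direction of cone C_i: C_0 is bisected by the upward vertical ray,
  cones numbered clockwise.\<close>
definition bisector :: "nat \<Rightarrow> nat \<Rightarrow> pt" where
  "bisector m i = dir (pi / 2 - real i * theta m)"

definition boundary_ray :: "nat \<Rightarrow> nat \<Rightarrow> pt" where
  "boundary_ray m j = dir (pi / 2 + theta m / 2 - real j * theta m)"

definition cross :: "pt \<Rightarrow> pt \<Rightarrow> real" where
  "cross a b = fst a * snd b - snd a * fst b"

text \<open>Cone C_i^u (closed; boundary rays contain no other points under general position).\<close>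
definition cone :: "nat \<Rightarrow> nat \<Rightarrow> pt \<Rightarrow> pt set" where
  "cone m i u = {v. v \<noteq> u \<and> (v - u) \<bullet> bisector m i \<ge> norm (v - u) * cos (theta m / 2)}"

definition general_position :: "nat \<Rightarrow> pt set \<Rightarrow> bool" where
  "general_position m P \<longleftrightarrow>
     (\<forall>p\<in>P. \<forall>q\<in>P. p \<noteq> q \<longrightarrow>
        (\<forall>j<m. cross (p - q) (boundary_ray m j) \<noteq> 0) \<and>
        (\<forall>i<m. (p - q) \<bullet> bisector m i \<noteq> 0)) \<and>
     (\<forall>p\<in>P. \<forall>q\<in>P. \<forall>r\<in>P. p \<noteq> q \<and> q \<noteq> r \<and> p \<noteq> r \<longrightarrow> cross (q - p) (r - p) \<noteq> 0)"

definition theta_edge :: "nat \<Rightarrow> pt set \<Rightarrow> pt \<Rightarrow> pt \<Rightarrow> bool" where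
  "theta_edge m P u w \<longleftrightarrow> u \<in> P \<and> w \<in> P \<and>
     (\<exists>i<m. w \<in> cone m i u \<and>
        (\<forall>x\<in>P. x \<in> cone m i u \<longrightarrow> (w - u) \<bullet> bisector m i \<le> (x - u) \<bullet> bisector m i))"

definition theta_path :: "nat \<Rightarrow> pt set \<Rightarrow> pt \<Rightarrow> pt \<Rightarrow> pt list \<Rightarrow> bool" where
  "theta_path m P u w xs \<longleftrightarrow> xs \<noteq> [] \<and> hd xs = u \<and> last xs = w \<and>
     (\<forall>i. Suc i < length xs \<longrightarrow>
        theta_edge m P (xs ! i) (xs ! Suc i) \<or> theta_edge m P (xs ! Suc i) (xs ! i))"

definition path_length :: "pt list \<Rightarrow> real" where
  "path_length xs = (\<Sum>i | Suc i < length xs. dist (xs ! i) (xs ! Suc i))"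

text \<open>Vertices of the side of the canonical triangle T_uw opposite u (w in cone C_i^u):
  intersections of the two boundary rays of C_i^u with the line through w
  perpendicular to the bisector.\<close>
definition tri_side_a :: "nat \<Rightarrow> nat \<Rightarrow> pt \<Rightarrow> pt \<Rightarrow> pt" where
  "tri_side_a m i u w = u + (((w - u) \<bullet> bisector m i) / cos (theta m / 2)) *\<^sub>R
      dir (pi / 2 - real i * theta m + theta m / 2)"

definition tri_side_b :: "nat \<Rightarrow> nat \<Rightarrow> pt \<Rightarrow> pt \<Rightarrow> pt" where
  "tri_side_b m i u w = u + (((w - u) \<bullet> bisector m i) / cos (theta m / 2)) *\<^sub>R
      dir (pi / 2 - real i * theta m - theta m / 2)"

definition tri_midpoint :: "nat \<Rightarrow> nat \<Rightarrow> pt \<Rightarrow> pt \<Rightarrow> pt" where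
  "tri_midpoint m i u w = midpoint (tri_side_a m i u w) (tri_side_b m i u w)"

definition vec_angle :: "pt \<Rightarrow> pt \<Rightarrow> real" where
  "vec_angle a b = arccos ((a \<bullet> b) / (norm a * norm b))"

end

(* With c the constant cos(theta/4) / (cos(theta/2) - sin(3 theta/4)) and a, b the corners of
   T_uw opposite u, the bound is Phi(u,w) = max (|ua| + c |aw|) (|ub| + c |bw|).  Let v be the
   theta-neighbour of u in the cone containing w.  Measuring w - v in the cone of u (even if w
   lies in another cone of v) the triangle inequality gives |uv| + Phi <= Phi(u,w).  At distance 1
   and angle x from the bisector Phi is the sinusoid (cos x + c sin(theta/2 + x)) / cos(theta/2),
   whose maximum lies exactly at x = pi/4 + theta/8 = (k+1) theta/2.  If w - v makes the angles
   f <= pi/2 and g with the bisectors of the cone of u and of the nearest cone of v, then g <= f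
   and f + g <= (k+1) theta, so passing to the nearest cone does not increase Phi.  Hence
   |uv| + Phi(v,w) <= Phi(u,w), and one can induct on Phi. *)

theory Submission
  imports Defs
begin

section \<open>The potential and the trigonometry of its constant\<close>

text \<open>With y and x the offsets of p along and across the bisector, y / cos(theta/2) is the
  length of a slanted side of the canonical triangle and tan(theta/2) y + |x| the distance from p to
  its farther base corner; the absolute value encodes the maximum over both corners. The formula
  also makes sense for p outside cone i, which the induction exploits.\<close>

definition canon_bound :: "real \<Rightarrow> nat \<Rightarrow> nat \<Rightarrow> pt \<Rightarrow> real" where
  "canon_bound c m i p =
     (p \<bullet> bisector m i) / cos (theta m / 2)
     + c * (tan (theta m / 2) * (p \<bullet> bisector m i) + \<bar>cross p (bisector m i)\<bar>)"

definition ratio_const :: "real \<Rightarrow> real" where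
  "ratio_const t = cos (t / 4) / (cos (t / 2) - sin (3 * t / 4))"

text \<open>Put s = pi/4 + t/8. The numerator of \<open>ratio_const t\<close> is sin(2s), and its
  denominator is a sum of two cosines equal to 2 cos(t/2 + s) cos s; the factor 2 cos s cancels. The
  result says that cos x + c sin(t/2 + x) has derivative 0 at x = s. The bound 2 pi/5 is exactly
  what keeps t/2 + s below a right angle.\<close>

lemma ratio_const_eq:
  assumes "0 < t" "t < 2 * pi / 5"
  shows "ratio_const t = sin (pi / 4 + t / 8) / cos (t / 2 + (pi / 4 + t / 8))"
    and "cos (t / 2 + (pi / 4 + t / 8)) > 0"
proof -
  define s where "s = pi / 4 + t / 8"
  have s: "0 < s" "s < pi / 2" "t / 2 + s < pi / 2"
    using assms by (auto simp: s_def field_simps)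
  show pos: "cos (t / 2 + (pi / 4 + t / 8)) > 0"
    using s assms by (intro cos_gt_zero) (auto simp: s_def)
  have cs: "cos s > 0"
    using s by (intro cos_gt_zero) auto
  have "cos (t / 4) = sin (2 * s)"
    by (simp add: s_def sin_add distrib_left)
  hence 1: "cos (t / 4) = 2 * sin s * cos s"
    by (simp add: sin_double)
  have "sin (3 * t / 4) = - cos (pi / 2 + 3 * t / 4)"
    by (simp add: cos_add)
  also have "pi / 2 + 3 * t / 4 = (t / 2 + s) + s"
    by (simp add: s_def)
  finally have 2: "sin (3 * t / 4) = - cos ((t / 2 + s) + s)" .
  have "cos (t / 2) = cos ((t / 2 + s) - s)"
    by simp
  hence 3: "cos (t / 2) - sin (3 * t / 4) = 2 * cos (t / 2 + s) * cos s"
    unfolding 2 cos_add[of "t / 2 + s" s] cos_diff[of "t / 2 + s" s] by simp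
  show "ratio_const t = sin (pi / 4 + t / 8) / cos (t / 2 + (pi / 4 + t / 8))"
    unfolding ratio_const_def 1 3 s_def[symmetric] using cs by simp
qed

lemma ratio_const_ge_1:
  assumes "0 < t" "t < 2 * pi / 5"
  shows "ratio_const t \<ge> 1"
proof -
  have "cos (t / 2 + (pi / 4 + t / 8)) \<le> cos (pi / 4)"
    using assms by (intro cos_monotone_0_pi_le) (auto simp: field_simps)
  also have "\<dots> = sin (pi / 4)"
    by (simp add: sin_45 cos_45)
  also have "\<dots> \<le> sin (pi / 4 + t / 8)"
    using assms by (intro sin_monotone_2pi_le) (auto simp: field_simps)
  finally show ?thesis
    using ratio_const_eq[OF assms] by simp
qed

text \<open>With s the mean and d the half difference of f and g, the difference of the two sides is
  a positive multiple of sin d times the derivative of cos x + c sin(t/2 + x) at s. That derivative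
  is nonnegative up to the maximum s0, and the bound on f + g says s \<le> s0. Thus f itself may lie
  beyond the maximum.\<close>

lemma sinusoid_mono:
  fixes t f g :: real
  assumes t: "0 < t" "t < 2 * pi / 5"
    and fg: "0 \<le> g" "g \<le> f" "f \<le> pi / 2" "f + g \<le> pi / 2 + t / 4"
  defines "c \<equiv> ratio_const t"
  shows "cos g / cos (t / 2) + c * (tan (t / 2) * cos g + sin g)
       \<le> cos f / cos (t / 2) + c * (tan (t / 2) * cos f + sin f)"
proof -
  define s d s0 where "s = (f + g) / 2" and "d = (f - g) / 2" and "s0 = pi / 4 + t / 8"
  have C: "cos (t / 2) > 0"
    using t by (intro cos_gt_zero) auto
  have F: "cos x / cos (t / 2) + c * (tan (t / 2) * cos x + sin x)
         = (cos x + c * sin (t / 2 + x)) / cos (t / 2)" for x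
    unfolding sin_add tan_def using C by (simp add: field_simps)
  have f: "f = s + d" and g: "g = s - d"
    by (auto simp: s_def d_def field_simps)
  have ss0: "0 \<le> s" "s \<le> s0" "s0 \<le> pi / 2" "t / 2 + s0 \<le> pi / 2"
    using fg t by (auto simp: s_def s0_def field_simps)
  have "sin s \<le> sin s0"
    using ss0 by (intro sin_monotone_2pi_le) auto
  \<comment> \<open>The derivative vanishes at s0: this is how c was chosen.\<close>
  also have "sin s0 = c * cos (t / 2 + s0)"
    using ratio_const_eq[OF t] by (simp add: c_def s0_def)
  also have "\<dots> \<le> c * cos (t / 2 + s)"
    using ss0 t ratio_const_ge_1[OF t]
    by (intro mult_left_mono cos_monotone_0_pi_le) (auto simp: c_def)
  finally have key: "0 \<le> c * cos (t / 2 + s) - sin s"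
    by simp
  have d0: "0 \<le> sin d"
    using fg by (intro sin_ge_zero) (auto simp: d_def field_simps)
  have e: "t / 2 + f = (t / 2 + s) + d" "t / 2 + g = (t / 2 + s) - d"
    by (auto simp: f g)
  have "(cos f + c * sin (t / 2 + f)) - (cos g + c * sin (t / 2 + g))
      = 2 * sin d * (c * cos (t / 2 + s) - sin s)"
    unfolding e unfolding f g sin_add[of "t / 2 + s" d] sin_diff[of "t / 2 + s" d]
      cos_add[of s d] cos_diff[of s d]
    by (simp add: algebra_simps)
  also have "\<dots> \<ge> 0"
    using key d0 by simp
  finally show ?thesis
    unfolding F using C by (intro divide_right_mono) auto
qed

section \<open>Coordinates along and across a bisector, and the cones\<close>

lemma inner_dir: "p \<bullet> dir a = fst p * cos a + snd p * sin a"
  by (simp add: dir_def inner_prod_def)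

lemma cross_dir: "cross p (dir a) = fst p * sin a - snd p * cos a"
  by (simp add: dir_def cross_def)

lemma inner_dir_diff: "p \<bullet> dir (a - b) = (p \<bullet> dir a) * cos b + cross p (dir a) * sin b"
  by (simp add: inner_dir cross_dir cos_diff sin_diff algebra_simps)

lemma cross_dir_diff: "cross p (dir (a - b)) = cross p (dir a) * cos b - (p \<bullet> dir a) * sin b"
  by (simp add: inner_dir cross_dir cos_diff sin_diff algebra_simps)

lemma norm_sq_dir: "(p \<bullet> dir a)\<^sup>2 + (cross p (dir a))\<^sup>2 = (norm p)\<^sup>2"
proof -
  have "(p \<bullet> dir a)\<^sup>2 + (cross p (dir a))\<^sup>2
      = ((fst p)\<^sup>2 + (snd p)\<^sup>2) * ((sin a)\<^sup>2 + (cos a)\<^sup>2)"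
    unfolding inner_dir cross_dir by algebra
  thus ?thesis
    by (simp add: norm_prod_def)
qed

lemma dir_int_periodic: "dir (a + 2 * pi * of_int n) = dir a"
  using sin_cos_eq_iff[of "a + 2 * pi * of_int n" a] unfolding dir_def by auto

text \<open>Squaring the angle condition in \<open>cone\<close> and using |p|^2 = y^2 + x^2 turns it
  into a bound on the slope |x| / y.\<close>

lemma cone_offset_bound:
  assumes "0 < theta m" "theta m < pi" and v: "v \<in> cone m i u"
  shows "(v - u) \<bullet> bisector m i \<ge> 0"
    and "\<bar>cross (v - u) (bisector m i)\<bar> \<le> tan (theta m / 2) * ((v - u) \<bullet> bisector m i)"
proof -
  define p y x where "p = v - u" and "y = p \<bullet> bisector m i" and "x = cross p (bisector m i)"
  have C: "cos (theta m / 2) > 0" and S: "sin (theta m / 2) > 0"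
    using assms by (auto intro!: cos_gt_zero sin_gt_zero)
  have yC: "norm p * cos (theta m / 2) \<le> y"
    using v by (simp add: cone_def p_def y_def)
  moreover have "0 \<le> norm p * cos (theta m / 2)"
    using C by simp
  ultimately have y0: "y \<ge> 0"
    by linarith
  have n: "y\<^sup>2 + x\<^sup>2 = (norm p)\<^sup>2"
    unfolding y_def x_def bisector_def by (rule norm_sq_dir)
  have "(norm p * cos (theta m / 2))\<^sup>2 \<le> y\<^sup>2"
    using yC C by (intro power_mono) auto
  hence "(y\<^sup>2 + x\<^sup>2) * (cos (theta m / 2))\<^sup>2 \<le> y\<^sup>2 * ((sin (theta m / 2))\<^sup>2 + (cos (theta m / 2))\<^sup>2)"
    unfolding n sin_cos_squared_add power_mult_distrib by simp
  hence "(x * cos (theta m / 2))\<^sup>2 \<le> (y * sin (theta m / 2))\<^sup>2"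
    unfolding power_mult_distrib distrib_left distrib_right by linarith
  hence "\<bar>x * cos (theta m / 2)\<bar> \<le> y * sin (theta m / 2)"
    using y0 S by (simp add: abs_le_square_iff[symmetric])
  hence "\<bar>x\<bar> \<le> tan (theta m / 2) * y"
    using C by (simp add: tan_def abs_mult field_simps)
  with y0 show "(v - u) \<bullet> bisector m i \<ge> 0"
    and "\<bar>cross (v - u) (bisector m i)\<bar> \<le> tan (theta m / 2) * ((v - u) \<bullet> bisector m i)"
    by (auto simp: x_def y_def p_def)
qed

section \<open>One edge is paid for by the drop of the potential\<close>

text \<open>Triangle inequality for the detour from u to v through a base corner of the canonical
  triangle of v, with the base part stretched by c \<ge> 1. The sign s selects the corner; both are
  needed, since the choice will depend on w and not on v.\<close>

lemma norm_le_detour: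
  assumes "0 < theta m" "theta m < pi" "v \<in> cone m i u" "c \<ge> 1" "s = 1 \<or> s = -1"
  shows "norm (v - u) \<le> ((v - u) \<bullet> bisector m i) / cos (theta m / 2)
    + c * (tan (theta m / 2) * ((v - u) \<bullet> bisector m i) + s * cross (v - u) (bisector m i))"
proof -
  define y x T D where "y = (v - u) \<bullet> bisector m i" and "x = cross (v - u) (bisector m i)"
    and "T = tan (theta m / 2)" and "D = 1 / cos (theta m / 2)"
  have C: "cos (theta m / 2) > 0"
    using assms by (auto intro!: cos_gt_zero)
  have T0: "T > 0"
    using assms by (auto simp: T_def intro!: tan_gt_zero)
  have D0: "D > 0" and DT: "D\<^sup>2 = 1 + T\<^sup>2"
    using C tan_sec[of "theta m / 2"] by (auto simp: D_def T_def inverse_eq_divide power_divide)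
  have y0: "y \<ge> 0" and xT: "\<bar>x\<bar> \<le> T * y"
    using cone_offset_bound[OF assms(1-3)] by (auto simp: x_def y_def T_def)
  define q where "q = T * y + s * x"
  have q0: "q \<ge> 0"
    using assms(5) xT by (auto simp: q_def)
  have "(norm (v - u))\<^sup>2 = y\<^sup>2 + x\<^sup>2"
    unfolding y_def x_def bisector_def by (rule norm_sq_dir[symmetric])
  also have "x\<^sup>2 = (q - T * y)\<^sup>2"
    using assms(5) by (auto simp: q_def)
  \<comment> \<open>Law of cosines at the corner, where the sides are D y and q: the cosine of the
    angle there is sin(theta/2), and D y sin(theta/2) = T y.\<close>
  also have "y\<^sup>2 + (q - T * y)\<^sup>2 = (D * y)\<^sup>2 + q\<^sup>2 - 2 * T * y * q"
    by (simp add: power_mult_distrib DT) algebra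
  also have "\<dots> \<le> (D * y)\<^sup>2 + q\<^sup>2 + 2 * (D * y) * q"
    using D0 T0 y0 q0 by (smt (verit) mult_nonneg_nonneg)
  also have "\<dots> = (D * y + q)\<^sup>2"
    by algebra
  finally have "norm (v - u) \<le> D * y + q"
    using D0 y0 q0 by (auto intro: power2_le_imp_le)
  also have "q \<le> c * q"
    using q0 assms(4) by (simp add: mult_le_cancel_right1)
  finally show ?thesis
    by (simp add: D_def y_def x_def q_def T_def)
qed

text \<open>Fixing s as the sign of the sideways offset of w - v makes the potential linear, so the
  detour for v - u and the terms for w - v add up to those for w - u. Only then is s x \<le> |x|
  used. All offsets refer to cone i of u, so w may lie in any direction from v.\<close>

lemma norm_add_canon_bound:
  assumes "0 < theta m" "theta m < pi" "v \<in> cone m i u" "c \<ge> 1"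
  shows "norm (v - u) + canon_bound c m i (w - v) \<le> canon_bound c m i (w - u)"
proof -
  define B where "B = bisector m i"
  define s :: real where "s = (if cross (w - v) B \<ge> 0 then 1 else -1)"
  have s: "s = 1 \<or> s = -1" "\<bar>cross (w - v) B\<bar> = s * cross (w - v) B"
    by (auto simp: s_def)
  have cr: "cross (w - u) B = cross (v - u) B + cross (w - v) B"
    by (simp add: cross_def algebra_simps)
  have ir: "(w - u) \<bullet> B = (v - u) \<bullet> B + (w - v) \<bullet> B"
    by (simp add: inner_diff_left)
  have lin: "a + (b / C + c * (T * b + e)) \<le> (d + b) / C + c * (T * (d + b) + (e' + e))"
    if "a \<le> d / C + c * (T * d + e')" for a b C T e d e' :: real
    using that by (simp add: algebra_simps add_divide_distrib)
  have "norm (v - u) + canon_bound c m i (w - v)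
      \<le> ((w - u) \<bullet> B) / cos (theta m / 2)
        + c * (tan (theta m / 2) * ((w - u) \<bullet> B) + s * cross (w - u) B)"
    using norm_le_detour[OF assms s(1)] unfolding canon_bound_def B_def[symmetric] s(2) ir cr distrib_left[of s]
    by (rule lin)
  also have "\<dots> \<le> canon_bound c m i (w - u)"
    unfolding canon_bound_def B_def[symmetric] using s(1) assms(4)
    by (intro add_mono mult_left_mono order.refl) auto
  finally show ?thesis .
qed

section \<open>Passing to the nearest cone\<close>

text \<open>Take n to be h = f/t rounded. If |n| \<le> k, then |h| \<le> k + 1/2 and the two terms
  sum to at most k + 1. Otherwise |n| = k + 1 exceeds |h|, and |h - n| = k + 1 - |h| makes the sum
  exactly k + 1.\<close>

lemma nearest_multiple:
  fixes f t :: real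
  assumes "t > 0" "\<bar>f\<bar> \<le> (real k + 3 / 4) * t"
  obtains n :: int where "\<bar>f - n * t\<bar> \<le> t / 2" "\<bar>f - n * t\<bar> \<le> \<bar>f\<bar>"
    "\<bar>f\<bar> + \<bar>f - n * t\<bar> \<le> (real k + 1) * t"
proof -
  define h where "h = f / t"
  have f: "f = h * t"
    using assms by (simp add: h_def)
  have h: "\<bar>h\<bar> \<le> real k + 3 / 4"
    using assms by (simp add: f abs_mult)
  define n where "n = round h"
  have n: "\<bar>h - n\<bar> \<le> 1 / 2"
    unfolding n_def using of_int_round_abs_le[of h] by linarith
  have n2: "n = 0 \<or> n \<ge> 1 \<or> n \<le> -1"
    by linarith
  have le: "\<bar>h - n\<bar> \<le> \<bar>h\<bar>"
    using n2
  proof (elim disjE)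
    assume "1 \<le> n"
    hence "real_of_int n \<ge> 1" by simp
    thus ?thesis using n by linarith
  next
    assume "n \<le> -1"
    hence "real_of_int n \<le> -1" by linarith
    thus ?thesis using n by linarith
  qed simp
  \<comment> \<open>|n| is at most |h| + 1/2 \<le> k + 5/4, so rounding cannot reach k + 2.\<close>
  have "real_of_int \<bar>n\<bar> < real_of_int (int k + 2)"
    using n h by (simp only: of_int_abs of_int_add of_int_of_nat_eq of_int_numeral)
  hence "\<bar>n\<bar> \<le> int k + 1"
    by linarith
  moreover have "\<bar>n\<bar> = int k + 1 \<or> \<bar>n\<bar> \<le> int k"
    using calculation by linarith
  ultimately have "\<bar>real_of_int n\<bar> = real k + 1 \<or> \<bar>real_of_int n\<bar> \<le> real k"
    by linarith
  hence sum: "\<bar>h\<bar> + \<bar>h - n\<bar> \<le> real k + 1"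
    using n h le by linarith
  have fn: "\<bar>f - n * t\<bar> = \<bar>h - n\<bar> * t" "\<bar>f\<bar> = \<bar>h\<bar> * t"
    using assms by (auto simp: f left_diff_distrib[symmetric] abs_mult)
  show ?thesis
  proof (rule that)
    show "\<bar>f - n * t\<bar> \<le> t / 2"
      unfolding fn using mult_right_mono[OF n, of t] assms by simp
    show "\<bar>f - n * t\<bar> \<le> \<bar>f\<bar>"
      unfolding fn using mult_right_mono[OF le, of t] assms by simp
    show "\<bar>f\<bar> + \<bar>f - n * t\<bar> \<le> (real k + 1) * t"
      unfolding fn using mult_right_mono[OF sum, of t] assms by (simp add: algebra_simps)
  qed
qed

text \<open>Reducing the index i + n modulo m changes the direction by whole turns only.\<close>

lemma bisector_rotate:
  fixes n :: int
  assumes "m > 0"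
  obtains j where "j < m" "bisector m j = dir (pi / 2 - real i * theta m - n * theta m)"
proof -
  define j where "j = nat ((int i + n) mod int m)"
  have "int j = (int i + n) mod int m"
    using assms by (simp add: j_def)
  hence "int i + n = int j + int m * ((int i + n) div int m)"
    by simp
  then obtain q where q: "int i + n = int j + int m * q"
    by blast
  have "of_int (int i + n) = (of_int (int j + int m * q) :: real)"
    by (simp only: q)
  hence q': "real i + n = real j + real m * q"
    by simp
  have mt: "real m * theta m = 2 * pi"
    using assms by (simp add: theta_def)
  have "pi / 2 - real i * theta m - n * theta m = pi / 2 - (real i + n) * theta m"
    by (simp add: algebra_simps)
  also have "\<dots> = pi / 2 - real j * theta m - (real m * theta m) * q"
    unfolding q' by (simp add: algebra_simps)
  also have "\<dots> = pi / 2 - real j * theta m + 2 * pi * of_int (- q)"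
    unfolding mt by simp
  finally have "dir (pi / 2 - real i * theta m - n * theta m) = bisector m j"
    unfolding bisector_def by (simp only: dir_int_periodic)
  moreover have "j < m"
    using assms by (simp add: j_def nat_less_iff)
  ultimately show ?thesis
    using that by metis
qed

text \<open>The residue of m modulo 4 enters here: a right angle is a quarter of m, that is k + 3/4,
  cone widths. The upper bound holds since m \<ge> 7.\<close>

lemma theta_bounds:
  assumes "k \<ge> 1" "m = 4 * k + 3"
  shows "0 < theta m" "theta m < 2 * pi / 5" "(real k + 3 / 4) * theta m = pi / 2"
proof -
  have m: "real m = 4 * real k + 3" "real k \<ge> 1"
    using assms by auto
  show "0 < theta m" and "(real k + 3 / 4) * theta m = pi / 2"
    using m by (auto simp: theta_def field_simps)
  have "pi * 5 < pi * (4 * real k + 3)"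
    using m(2) by (intro mult_strict_left_mono) auto
  thus "theta m < 2 * pi / 5"
    using m by (simp add: theta_def field_simps)
qed

text \<open>In polar coordinates around v both potentials are |w - v| times the sinusoid at the
  unsigned angle to the respective bisector. Rounding the angle to a multiple of theta supplies the
  hypotheses of \<open>sinusoid_mono\<close>.\<close>

lemma canon_bound_nearest_cone:
  assumes k: "k \<ge> 1" "m = 4 * k + 3"
    and z: "w \<noteq> v" "(w - v) \<bullet> bisector m i \<ge> 0"
  obtains j where "j < m" "w \<in> cone m j v"
    "canon_bound (ratio_const (theta m)) m j (w - v) \<le> canon_bound (ratio_const (theta m)) m i (w - v)"
proof -
  define t where "t = theta m"
  note t = theta_bounds[OF k, folded t_def]
  define A r where "A = pi / 2 - real i * t" and "r = norm (w - v)"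
  have B: "bisector m i = dir A"
    by (simp add: bisector_def A_def t_def)
  have r: "r > 0"
    using z by (simp add: r_def)
  \<comment> \<open>The signed angle from bisector i to w - v. \<open>arcsin\<close> takes values
    between -pi/2 and pi/2, the right range because the offset along the bisector is
    nonnegative.\<close>
  define f where "f = arcsin (cross (w - v) (dir A) / r)"
  have n: "((w - v) \<bullet> dir A / r)\<^sup>2 + (cross (w - v) (dir A) / r)\<^sup>2 = 1"
    using norm_sq_dir[of "w - v" A] r
    by (simp add: power_divide add_divide_distrib[symmetric] r_def[symmetric])
  hence "(cross (w - v) (dir A) / r)\<^sup>2 \<le> 1"
    by (smt (verit) zero_le_power2)
  hence "\<bar>cross (w - v) (dir A) / r\<bar> \<le> 1"
    by (simp only: abs_square_le_1)
  hence x1: "-1 \<le> cross (w - v) (dir A) / r" "cross (w - v) (dir A) / r \<le> 1"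
    by linarith+
  have sf: "cross (w - v) (dir A) = r * sin f"
    using x1 r by (simp add: f_def)
  have f2: "\<bar>f\<bar> \<le> pi / 2"
    using arcsin_lbound[OF x1] arcsin_ubound[OF x1] unfolding f_def by linarith
  have "cos f = sqrt (1 - (cross (w - v) (dir A) / r)\<^sup>2)"
    using x1 by (simp add: f_def cos_arcsin)
  also have "1 - (cross (w - v) (dir A) / r)\<^sup>2 = ((w - v) \<bullet> dir A / r)\<^sup>2"
    using n by linarith
  also have "sqrt \<dots> = (w - v) \<bullet> dir A / r"
    using z(2) r by (simp add: B)
  finally have cf: "(w - v) \<bullet> dir A = r * cos f"
    using r by simp
  obtain N :: int where N: "\<bar>f - N * t\<bar> \<le> t / 2" "\<bar>f - N * t\<bar> \<le> \<bar>f\<bar>"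
    "\<bar>f\<bar> + \<bar>f - N * t\<bar> \<le> (real k + 1) * t"
    using nearest_multiple[of t f k] t f2 by auto
  obtain j where j: "j < m" "bisector m j = dir (A - N * t)"
    using bisector_rotate[of m i N] k unfolding A_def t_def by auto
  \<comment> \<open>Positive angles run clockwise, like the cone numbers, so moving N cones on
    subtracts N t.\<close>
  define g where "g = f - N * t"
  have cg: "(w - v) \<bullet> bisector m j = r * cos g"
    unfolding j inner_dir_diff cf sf g_def cos_diff by (simp add: algebra_simps)
  have sg: "cross (w - v) (bisector m j) = r * sin g"
    unfolding j cross_dir_diff cf sf g_def sin_diff by (simp add: algebra_simps)
  have abs_sin: "\<bar>sin x\<bar> = sin \<bar>x\<bar>" if "\<bar>x\<bar> \<le> pi / 2" for x :: real
  proof -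
    have "sin \<bar>x\<bar> \<ge> 0"
      using that by (intro sin_ge_zero) auto
    thus ?thesis
      by (cases "x \<ge> 0") auto
  qed
  have g2: "\<bar>g\<bar> \<le> pi / 2"
    using N(2) f2 by (simp add: g_def)
  have canon: "canon_bound c m l (w - v)
      = r * (cos \<bar>x\<bar> / cos (t / 2) + c * (tan (t / 2) * cos \<bar>x\<bar> + sin \<bar>x\<bar>))"
    if "(w - v) \<bullet> bisector m l = r * cos x" "cross (w - v) (bisector m l) = r * sin x"
      "\<bar>x\<bar> \<le> pi / 2" for c l x
    using r unfolding canon_bound_def that(1,2) abs_mult abs_sin[OF that(3)] t_def
    by (simp add: algebra_simps)
  have "canon_bound (ratio_const t) m j (w - v) \<le> canon_bound (ratio_const t) m i (w - v)"
    unfolding canon[OF cg sg g2] canon[OF cf[folded B] sf[folded B] f2]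
  proof (intro mult_left_mono sinusoid_mono)
    \<comment> \<open>Twice the position pi/4 + t/8 of the maximum is k + 1 cone widths.\<close>
    have "(real k + 1) * t = pi / 2 + t / 4"
      unfolding t(3)[symmetric] by (simp add: algebra_simps)
    thus "\<bar>f\<bar> + \<bar>g\<bar> \<le> pi / 2 + t / 4"
      using N(3) by (simp add: g_def)
  qed (use t N r f2 in \<open>auto simp: g_def\<close>)
  moreover have "w \<in> cone m j v"
  proof -
    have "cos (t / 2) \<le> cos \<bar>g\<bar>"
      using N(1) t by (intro cos_monotone_0_pi_le) (auto simp: g_def)
    thus ?thesis
      using z(1) r cg by (simp add: cone_def t_def r_def[symmetric])
  qed
  ultimately show ?thesis
    using that j(1) unfolding t_def by blast
qed

section \<open>Building the path by induction on the potential\<close>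

lemma theta_path_Cons:
  assumes "theta_path m P v w xs" "theta_edge m P u v"
  shows "theta_path m P u w (u # xs)"
    and "path_length (u # xs) = dist u v + path_length xs"
proof -
  have xs: "xs \<noteq> []" "hd xs = v" "last xs = w"
    using assms by (auto simp: theta_path_def)
  hence x0: "xs ! 0 = v"
    by (simp add: hd_conv_nth)
  show "theta_path m P u w (u # xs)"
    unfolding theta_path_def
  proof (intro conjI allI impI)
    fix l assume "Suc l < length (u # xs)"
    thus "theta_edge m P ((u # xs) ! l) ((u # xs) ! Suc l) \<or>
          theta_edge m P ((u # xs) ! Suc l) ((u # xs) ! l)"
      using assms x0 by (cases l) (auto simp: theta_path_def)
  qed (use xs in auto)
  have I: "{l. Suc l < length (u # xs)} = insert 0 (Suc ` {l. Suc l < length xs})"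
    using xs(1) by (auto simp: image_iff) (metis Suc_less_eq not0_implies_Suc)
  have fin: "finite {l. Suc l < length xs}"
    by (rule finite_subset[of _ "{..<length xs}"]) auto
  show "path_length (u # xs) = dist u v + path_length xs"
    unfolding path_length_def I using fin x0
    by (subst sum.insert) (auto simp: sum.reindex)
qed

text \<open>The last conclusion is minimality of v tested against w; it confines w - v to a right
  angle around the bisector, as \<open>canon_bound_nearest_cone\<close> requires.\<close>

lemma theta_neighbour_exists:
  assumes "finite P" "u \<in> P" "w \<in> P" "i < m" "w \<in> cone m i u"
  obtains v where "v \<in> P" "theta_edge m P u v" "v \<in> cone m i u"
    "(w - v) \<bullet> bisector m i \<ge> 0"
proof -
  have "finite (P \<inter> cone m i u)" "P \<inter> cone m i u \<noteq> {}"
    using assms by auto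
  from ex_min_if_finite[OF finite_imageI[OF this(1), of "\<lambda>x. (x - u) \<bullet> bisector m i"]] this(2)
  obtain v where v: "v \<in> P" "v \<in> cone m i u"
    "\<And>x. x \<in> P \<Longrightarrow> x \<in> cone m i u \<Longrightarrow> (v - u) \<bullet> bisector m i \<le> (x - u) \<bullet> bisector m i"
    by (auto simp: not_less)
  show ?thesis
  proof (rule that)
    show "theta_edge m P u v"
      using assms v by (auto simp: theta_edge_def)
    show "(w - v) \<bullet> bisector m i \<ge> 0"
      using v(3)[OF assms(3,5)] by (simp add: inner_diff_left)
  qed (use v in auto)
qed

lemma theta_path_canon_bound:
  assumes k: "k \<ge> 1" "m = 4 * k + 3" and "finite P" and w: "w \<in> P"
    and "u \<in> P" "i < m" "w \<in> cone m i u"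
  defines "c \<equiv> ratio_const (theta m)"
  shows "\<exists>xs. theta_path m P u w xs \<and> path_length xs \<le> canon_bound c m i (w - u)"
proof -
  \<comment> \<open>The state includes the cone index, since the potential is measured in a chosen
    cone containing w.\<close>
  define \<Phi> where "\<Phi> = (\<lambda>(i, u). canon_bound c m i (w - u))"
  define R where "R = {(y, x). y \<in> {..<m} \<times> P \<and> x \<in> {..<m} \<times> P \<and> \<Phi> y < \<Phi> x}"
  note t = theta_bounds[OF k]
  have tpi: "theta m < pi"
    using t by linarith
  have c1: "c \<ge> 1"
    unfolding c_def using t by (intro ratio_const_ge_1) auto
  \<comment> \<open>Decrease of a real potential alone does not give termination; finitely many
    states do.\<close>
  have "finite R"
    by (rule finite_subset[of _ "({..<m} \<times> P) \<times> ({..<m} \<times> P)"])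
      (auto simp: R_def \<open>finite P\<close>)
  moreover have "acyclic R"
    by (rule acyclicI_order[where f = "\<lambda>x. - \<Phi> x"]) (auto simp: R_def)
  ultimately have "wf R"
    by (rule finite_acyclic_wf)
  have "fst x < m \<Longrightarrow> snd x \<in> P \<Longrightarrow> w \<in> cone m (fst x) (snd x) \<Longrightarrow>
      \<exists>xs. theta_path m P (snd x) w xs \<and> path_length xs \<le> \<Phi> x" for x
    using \<open>wf R\<close>
  proof (induction x rule: wf_induct_rule)
    case (less x)
    obtain i u where x: "x = (i, u)"
      by (cases x)
    have iu: "i < m" "u \<in> P" "w \<in> cone m i u"
      using less.prems by (auto simp: x)
    obtain v where v: "v \<in> P" "theta_edge m P u v" "v \<in> cone m i u"
      "(w - v) \<bullet> bisector m i \<ge> 0"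
      using theta_neighbour_exists[OF \<open>finite P\<close> iu(2) w iu(1,3)] by blast
    have step: "dist u v + canon_bound c m i (w - v) \<le> canon_bound c m i (w - u)"
      using norm_add_canon_bound[OF t(1) tpi v(3) c1, of w]
      by (simp add: dist_norm norm_minus_commute)
    have "\<exists>xs. theta_path m P v w xs \<and> path_length xs \<le> canon_bound c m i (w - v)"
    \<comment> \<open>At v = w no cone of v contains w, but the offset is 0 and so is the potential,
      which the one-vertex path meets.\<close>
    proof (cases "v = w")
      case True
      have "theta_path m P v w [w]" "path_length [w] \<le> canon_bound c m i (w - v)"
        using True by (auto simp: theta_path_def path_length_def canon_bound_def cross_def)
      thus ?thesis
        by blast
    next
      case False
      obtain j where j: "j < m" "w \<in> cone m j v"
        "canon_bound c m j (w - v) \<le> canon_bound c m i (w - v)"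
        using canon_bound_nearest_cone[OF k _ v(4)] False unfolding c_def by metis
      \<comment> \<open>A positive edge length turns the estimate into the strict decrease demanded
        by R.\<close>
      have "dist u v > 0"
        using v(3) by (auto simp: cone_def)
      hence "canon_bound c m j (w - v) < canon_bound c m i (w - u)"
        using j(3) step by linarith
      hence "((j, v), x) \<in> R"
        using j v(1) iu by (auto simp: R_def \<Phi>_def x)
      from less.IH[OF this] j v(1) show ?thesis
        by (fastforce simp: \<Phi>_def)
    qed
    then obtain xs where xs: "theta_path m P v w xs"
      "path_length xs \<le> canon_bound c m i (w - v)"
      by blast
    show ?case
      using theta_path_Cons[OF xs(1) v(2)] xs(2) step by (fastforce simp: x \<Phi>_def)
  qed
  from this[of "(i, u)"] assms(5-7) show ?thesis
    by (simp add: \<Phi>_def)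
qed

section \<open>The potential in terms of the angle alpha\<close>

text \<open>The two side directions, at theta/2 on either side of the bisector, average to
  cos(theta/2) times the bisector, cancelling the denominator in the corners.\<close>

lemma tri_midpoint_eq:
  assumes "cos (theta m / 2) \<noteq> 0"
  shows "tri_midpoint m i u w - u = ((w - u) \<bullet> bisector m i) *\<^sub>R bisector m i"
proof -
  define h where "h = (w - u) \<bullet> bisector m i"
  show ?thesis
    using assms
    unfolding tri_midpoint_def tri_side_a_def tri_side_b_def h_def[symmetric] midpoint_def
    unfolding bisector_def dir_def cos_add cos_diff sin_add sin_diff
    by (cases u) (simp add: field_simps)
qed

text \<open>The midpoint lies on the bisector at positive height y, so \<alpha> is the unsigned
  angle to the bisector: cos \<alpha> = y/r and sin \<alpha> = |x|/r, the absolute value matching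
  the one in \<open>canon_bound\<close>.\<close>

lemma canon_bound_eq_angle:
  assumes "0 < theta m" "theta m < pi" "w \<in> cone m i u"
  defines "\<alpha> \<equiv> vec_angle (w - u) (tri_midpoint m i u w - u)"
  shows "canon_bound c m i (w - u) =
    (cos \<alpha> / cos (theta m / 2) + (cos \<alpha> * tan (theta m / 2) + sin \<alpha>) * c) * dist u w"
proof -
  define y x r where "y = (w - u) \<bullet> bisector m i" and "x = cross (w - u) (bisector m i)"
    and "r = norm (w - u)"
  have C: "cos (theta m / 2) > 0"
    using assms by (auto intro!: cos_gt_zero)
  have r: "r > 0"
    using assms by (auto simp: r_def cone_def)
  have du: "dist u w = r"
    by (simp add: r_def dist_norm norm_minus_commute)
  have "r * cos (theta m / 2) \<le> y"
    using assms by (auto simp: r_def cone_def y_def)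
  moreover have "0 < r * cos (theta m / 2)"
    using r C by simp
  ultimately have y: "y > 0"
    by linarith
  have n: "y\<^sup>2 + x\<^sup>2 = r\<^sup>2"
    unfolding y_def x_def bisector_def r_def by (rule norm_sq_dir)
  hence "y\<^sup>2 \<le> r\<^sup>2"
    by (metis add_le_cancel_left add_0_right zero_le_power2)
  hence yr: "y \<le> r"
    using r by (simp add: power2_le_iff_abs_le)
  have "norm (bisector m i) = 1"
    by (simp add: bisector_def dir_def norm_prod_def)
  moreover have "tri_midpoint m i u w - u = y *\<^sub>R bisector m i"
    using tri_midpoint_eq[of m i u w] C by (simp add: y_def)
  ultimately have "\<alpha> = arccos (y * y / (r * y))"
    using y unfolding \<alpha>_def vec_angle_def by (simp add: y_def[symmetric] r_def[symmetric])
  hence \<alpha>: "\<alpha> = arccos (y / r)"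
    using y by simp
  have yr1: "-1 \<le> y / r" "y / r \<le> 1"
    using y yr r by (auto intro: order.trans[of _ 0])
  have ca: "cos \<alpha> = y / r"
    using yr1 by (simp add: \<alpha>)
  have "sin \<alpha> = sqrt (1 - (y / r)\<^sup>2)"
    using yr1 by (simp add: \<alpha> sin_arccos)
  also have "1 - (y / r)\<^sup>2 = (x / r)\<^sup>2"
    using n r by (simp add: power_divide field_simps)
  finally have sa: "sin \<alpha> = \<bar>x\<bar> / r"
    using r by simp
  show ?thesis
    unfolding canon_bound_def ca sa y_def[symmetric] x_def[symmetric] du
    using r C by (simp add: field_simps)
qed

theorem mainTheorem11:
  fixes k :: nat and P :: "pt set" and u w :: pt and i :: nat
  assumes "k \<ge> 1"
    and "finite P"
    and "general_position (4 * k + 3) P"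
    and "u \<in> P" and "w \<in> P"
    and "i < 4 * k + 3" and "w \<in> cone (4 * k + 3) i u"
  shows "\<exists>xs. theta_path (4 * k + 3) P u w xs \<and>
           path_length xs \<le>
             (let m = 4 * k + 3; \<theta> = theta m;
                  \<alpha> = vec_angle (w - u) (tri_midpoint m i u w - u)
              in (cos \<alpha> / cos (\<theta> / 2)
                  + (cos \<alpha> * tan (\<theta> / 2) + sin \<alpha>) * cos (\<theta> / 4)
                    / (cos (\<theta> / 2) - sin (3 * \<theta> / 4))) * dist u w)"
proof -
  have t: "0 < theta (4 * k + 3)" "theta (4 * k + 3) < pi"
    using theta_bounds[OF assms(1) refl] by linarith+
  show ?thesis
    using theta_path_canon_bound[OF assms(1) refl assms(2,5,4,6,7)]
    unfolding canon_bound_eq_angle[OF t assms(7)] Let_def ratio_const_def times_divide_eq_right .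
qed

end
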